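(* Let $\mathcal{A}$ be any alphabet set (a discrete set, finite or infinite, or a metric space $(\mathcal{A},d)$), let $(\Omega,\sigma)$ be a subshift of $(\mathcal{A}^{\mathbb{N}},\sigma)$, and let $\overline{\sigma}$ be the induced map on the hyperspace $\mathcal{K}(\Omega)$ of nonempty compact subsets of $\Omega$. Then $(\Omega,\sigma)$ is weakly mixing if and only if $(\mathcal{K}(\Omega),\overline{\sigma})$ is weakly mixing.
   Context: Sequences are indexed from $0$ and $\sigma(x_0x_1x_2\ldots)=x_1x_2x_3\ldots$. A subshift of $\mathcal{A}^{\mathbb{N}}$ is a nonempty closed subset $\Omega$ with $\sigma(\Omega)\subseteq\Omega$. The space $\mathcal{A}^{\mathbb{N}}$ carries the metric $D$, where $D(\bar x,\bar y)=\sum_{i=0}^\infty \frac{\delta(x_i,y_i)}{2^i}$ ($\delta$ the discrete metric) if $\mathcal{A}$ is a discrete alphabet, and $D(\bar x,\bar y)=\sum_{i=0}^\infty \frac{1}{2^i}\frac{d(x_i,y_i)}{1+d(x_i,y_i)}$ if $\mathcal{A}$ is a general metric space. $\mathcal{K}(\Omega)$ carries the Hausdorff metric $D_H$ induced by $D$, and $\overline{\sigma}(K)=\sigma(K)$. A continuous $f:X\to X$ is transitive if for any nonempty open $U,V\subseteq X$ there is a positive integer $n$ with $f^n(U)\cap V\neq\emptyset$; it is weakly mixing if $f\times f$ is transitive on $X\times X$. *)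

theory Defs
  imports "HOL-Analysis.Analysis"
begin

abbreviation full_space :: "'a set \<Rightarrow> (nat \<Rightarrow> 'a) set" where
  "full_space A \<equiv> UNIV \<rightarrow> A"

definition shift :: "(nat \<Rightarrow> 'a) \<Rightarrow> (nat \<Rightarrow> 'a)" where
  "shift x = (\<lambda>i. x (Suc i))"

text \<open>A discrete alphabet and a metric alphabet get different (equivalent) normalisations:
  the discrete metric enters the first sum directly, without the factor \<open>t / (1 + t)\<close>.\<close>

definition seq_dist_discrete :: "(nat \<Rightarrow> 'a) \<Rightarrow> (nat \<Rightarrow> 'a) \<Rightarrow> real" where
  "seq_dist_discrete x y = (\<Sum>i. discrete_metric.dd (x i) (y i) / 2 ^ i)"

definition seq_dist_metric ::
    "('a \<Rightarrow> 'a \<Rightarrow> real) \<Rightarrow> (nat \<Rightarrow> 'a) \<Rightarrow> (nat \<Rightarrow> 'a) \<Rightarrow> real" where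
  "seq_dist_metric d x y = (\<Sum>i. 1 / 2 ^ i * (d (x i) (y i) / (1 + d (x i) (y i))))"

definition subshift ::
    "'a set \<Rightarrow> ((nat \<Rightarrow> 'a) \<Rightarrow> (nat \<Rightarrow> 'a) \<Rightarrow> real) \<Rightarrow> (nat \<Rightarrow> 'a) set \<Rightarrow> bool" where
  "subshift A D \<Omega> \<longleftrightarrow>
     \<Omega> \<noteq> {} \<and> closedin (Metric_space.mtopology (full_space A) D) \<Omega> \<and> shift ` \<Omega> \<subseteq> \<Omega>"

definition hyperspace :: "'a set \<Rightarrow> ('a \<Rightarrow> 'a \<Rightarrow> real) \<Rightarrow> 'a set set" where
  "hyperspace X D = {K. K \<noteq> {} \<and> compactin (Metric_space.mtopology X D) K}"

text \<open>The value at the empty set is irrelevant for the hyperspace of nonempty compact sets.  It is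
  set to 0 because the locale \<open>Metric_space\<close> demands nonnegativity on the whole type, and
  \<open>Sup {}\<close> is an unspecified real.\<close>

definition hausdorff_dist :: "('a \<Rightarrow> 'a \<Rightarrow> real) \<Rightarrow> 'a set \<Rightarrow> 'a set \<Rightarrow> real" where
  "hausdorff_dist D K L =
     (if K = {} \<or> L = {} then 0
      else max (SUP x\<in>K. INF y\<in>L. D x y) (SUP y\<in>L. INF x\<in>K. D x y))"

definition transitive_map :: "'a topology \<Rightarrow> ('a \<Rightarrow> 'a) \<Rightarrow> bool" where
  "transitive_map X f \<longleftrightarrow>
     continuous_map X X f \<and>
     (\<forall>U V. openin X U \<and> U \<noteq> {} \<and> openin X V \<and> V \<noteq> {} \<longrightarrow>
        (\<exists>n>0. (f ^^ n) ` U \<inter> V \<noteq> {}))"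

definition weakly_mixing :: "'a topology \<Rightarrow> ('a \<Rightarrow> 'a) \<Rightarrow> bool" where
  "weakly_mixing X f \<longleftrightarrow>
     continuous_map X X f \<and> transitive_map (prod_topology X X) (map_prod f f)"

end

theory Submission
  imports Defs
begin

text \<open>The shift is Lipschitz for \<open>D\<close>, and only this and the boundedness of \<open>D\<close> matter. If \<open>\<sigma>\<close> is weakly
  mixing, then by Furstenberg one \<open>n\<close> serves finitely many pairs of open sets at once; since finite
  sets are dense in the hyperspace, applying this to small balls around the points of finite sets
  \<open>F\<close>, \<open>G\<close> moves a finite set near \<open>F\<close> to one near \<open>G\<close>. Conversely, a small Hausdorff ball around a
  singleton \<open>{x}\<close>, \<open>x \<in> U\<close>, consists of compact sets contained in \<open>U\<close>, so mixing in the hyperspace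
  descends to points.\<close>

section \<open>Weak mixing of all orders\<close>

lemma funpow_map_prod:
  fixes f :: "'a \<Rightarrow> 'a" and g :: "'b \<Rightarrow> 'b"
  shows "map_prod f g ^^ n = map_prod (f ^^ n) (g ^^ n)"
  by (induction n) (auto simp: fun_eq_iff)

text \<open>Open boxes form a base of the product topology, so transitivity of
  \<open>map_prod f f\<close> need only be tested on boxes, where it splits into two conditions with
  a common \<open>n\<close>.\<close>

lemma weakly_mixing_iff:
  "weakly_mixing X f \<longleftrightarrow> continuous_map X X f \<and>
     (\<forall>U1 V1 U2 V2. openin X U1 \<and> U1 \<noteq> {} \<and> openin X V1 \<and> V1 \<noteq> {} \<and>
        openin X U2 \<and> U2 \<noteq> {} \<and> openin X V2 \<and> V2 \<noteq> {} \<longrightarrow>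
        (\<exists>n>0. (\<exists>x\<in>U1. (f ^^ n) x \<in> V1) \<and> (\<exists>x\<in>U2. (f ^^ n) x \<in> V2)))"
    (is "?L \<longleftrightarrow> ?c \<and> ?R")
proof
  assume L: ?L
  show "?c \<and> ?R"
  proof (intro conjI allI impI; (elim conjE)?)
    show ?c using L by (simp add: weakly_mixing_def)
  next
    fix U1 V1 U2 V2
    assume o: "openin X U1" "U1 \<noteq> {}" "openin X V1" "V1 \<noteq> {}"
      "openin X U2" "U2 \<noteq> {}" "openin X V2" "V2 \<noteq> {}"
    have "openin (prod_topology X X) (U1 \<times> U2)" "openin (prod_topology X X) (V1 \<times> V2)"
      using o by (simp_all add: openin_prod_Times_iff)
    moreover have "U1 \<times> U2 \<noteq> {}" "V1 \<times> V2 \<noteq> {}" using o by auto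
    ultimately obtain n where "n > 0" "(map_prod f f ^^ n) ` (U1 \<times> U2) \<inter> (V1 \<times> V2) \<noteq> {}"
      using L unfolding weakly_mixing_def transitive_map_def by metis
    then show "\<exists>n>0. (\<exists>x\<in>U1. (f ^^ n) x \<in> V1) \<and> (\<exists>x\<in>U2. (f ^^ n) x \<in> V2)"
      by (auto simp: funpow_map_prod)
  qed
next
  assume "?c \<and> ?R"
  then have c: ?c and R: ?R by blast+
  have "continuous_map (prod_topology X X) (prod_topology X X) (map_prod f f)"
    unfolding map_prod_def using c by (simp add: continuous_map_prod_top)
  moreover have "\<exists>n>0. (map_prod f f ^^ n) ` U \<inter> V \<noteq> {}"
    if U: "openin (prod_topology X X) U" "U \<noteq> {}" and V: "openin (prod_topology X X) V" "V \<noteq> {}"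
    for U V
  proof -
    have box: "\<exists>S1 S2. openin X S1 \<and> openin X S2 \<and> S1 \<noteq> {} \<and> S2 \<noteq> {} \<and> S1 \<times> S2 \<subseteq> S"
      if "openin (prod_topology X X) S" "S \<noteq> {}" for S
    proof -
      obtain a b where "(a, b) \<in> S" using \<open>S \<noteq> {}\<close> by auto
      then obtain S1 S2 where "openin X S1" "openin X S2" "a \<in> S1" "b \<in> S2" "S1 \<times> S2 \<subseteq> S"
        using \<open>openin (prod_topology X X) S\<close> unfolding openin_prod_topology_alt by meson
      then show ?thesis by blast
    qed
    obtain U1 U2 where U12: "openin X U1" "openin X U2" "U1 \<noteq> {}" "U2 \<noteq> {}" "U1 \<times> U2 \<subseteq> U"
      using box[OF U] by blast
    obtain V1 V2 where V12: "openin X V1" "openin X V2" "V1 \<noteq> {}" "V2 \<noteq> {}" "V1 \<times> V2 \<subseteq> V"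
      using box[OF V] by blast
    obtain n x y where n: "n > 0" and xy: "x \<in> U1" "(f ^^ n) x \<in> V1" "y \<in> U2" "(f ^^ n) y \<in> V2"
      using R[rule_format, of U1 V1 U2 V2] U12 V12 by blast
    have "(x, y) \<in> U" "((f ^^ n) x, (f ^^ n) y) \<in> V" using xy U12 V12 by auto
    then have "(map_prod f f ^^ n) (x, y) \<in> (map_prod f f ^^ n) ` U \<inter> V"
      by (auto simp: funpow_map_prod intro: rev_image_eqI)
    then show ?thesis using n by blast
  qed
  ultimately show ?L
    using c by (simp add: weakly_mixing_def transitive_map_def)
qed

lemma continuous_map_funpow:
  "continuous_map X X f \<Longrightarrow> continuous_map X X (f ^^ n)"
  by (induction n) (auto intro: continuous_map_compose simp: continuous_map_id[unfolded id_def] id_def)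

text \<open>With \<open>N(U, V)\<close> the set of \<open>n > 0\<close> such that \<open>f\<^sup>n\<close> sends some point of \<open>U\<close> into \<open>V\<close>: for
  \<open>n \<in> N(U1, U2) \<inter> N(V1, V2)\<close> the sets \<open>U1 \<inter> f\<^sup>-\<^sup>n U2\<close> and \<open>V1 \<inter> f\<^sup>-\<^sup>n V2\<close> are nonempty and open,
  and they serve as \<open>U\<close> and \<open>V\<close>.\<close>

lemma weakly_mixing_pair_reduction:
  assumes "weakly_mixing X f"
    and o: "openin X U1" "U1 \<noteq> {}" "openin X V1" "V1 \<noteq> {}"
      "openin X U2" "U2 \<noteq> {}" "openin X V2" "V2 \<noteq> {}"
  obtains U V where "openin X U" "U \<noteq> {}" "openin X V" "V \<noteq> {}"
    "\<forall>m. (\<exists>x\<in>U. (f ^^ m) x \<in> V) \<longrightarrow> (\<exists>x\<in>U1. (f ^^ m) x \<in> V1) \<and> (\<exists>x\<in>U2. (f ^^ m) x \<in> V2)"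
proof -
  have cont: "continuous_map X X f" using assms by (simp add: weakly_mixing_def)
  obtain n where n: "\<exists>x\<in>U1. (f ^^ n) x \<in> U2" "\<exists>x\<in>V1. (f ^^ n) x \<in> V2"
    using assms unfolding weakly_mixing_iff by metis
  define U where "U = {x \<in> topspace X. (f ^^ n) x \<in> U2} \<inter> U1"
  define V where "V = {x \<in> topspace X. (f ^^ n) x \<in> V2} \<inter> V1"
  show ?thesis
  proof
    show "openin X U" "openin X V"
      unfolding U_def V_def
      using o openin_continuous_map_preimage[OF continuous_map_funpow[OF cont]] by blast+
    show "U \<noteq> {}" "V \<noteq> {}"
      using n o(1,3)[THEN openin_subset] by (auto simp: U_def V_def)
    have "(\<exists>x\<in>U1. (f ^^ m) x \<in> V1) \<and> (\<exists>x\<in>U2. (f ^^ m) x \<in> V2)"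
      if m: "\<exists>x\<in>U. (f ^^ m) x \<in> V" for m
    proof -
      obtain x where "x \<in> U" "(f ^^ m) x \<in> V" using m by blast
      \<comment> \<open>The iterates commute, so \<open>(f ^^ n) x\<close> is a point of
        \<open>U2\<close> that \<open>f ^^ m\<close> sends into \<open>V2\<close>.\<close>
      moreover have "(f ^^ n) ((f ^^ m) x) = (f ^^ m) ((f ^^ n) x)"
        by (metis add.commute comp_apply funpow_add)
      ultimately show ?thesis
        unfolding U_def V_def by auto
    qed
    then show "\<forall>m. (\<exists>x\<in>U. (f ^^ m) x \<in> V) \<longrightarrow> (\<exists>x\<in>U1. (f ^^ m) x \<in> V1) \<and> (\<exists>x\<in>U2. (f ^^ m) x \<in> V2)"
      by blast
  qed
qed

text \<open>Induction on \<open>P\<close>: the new pair is merged with the pair that already stands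
  for the rest. The conclusion provides open sets instead of a single time, because only open sets
  can be merged again.\<close>

lemma weakly_mixing_finite_reduction:
  assumes wm: "weakly_mixing X f" and "finite P" "P \<noteq> {}"
    and "\<And>U V. (U, V) \<in> P \<Longrightarrow> openin X U \<and> U \<noteq> {} \<and> openin X V \<and> V \<noteq> {}"
  shows "\<exists>U V. openin X U \<and> U \<noteq> {} \<and> openin X V \<and> V \<noteq> {} \<and>
    (\<forall>n. (\<exists>x\<in>U. (f ^^ n) x \<in> V) \<longrightarrow> (\<forall>(U', V')\<in>P. \<exists>x\<in>U'. (f ^^ n) x \<in> V'))"
  using assms(2-4)
proof (induction rule: finite_ne_induct)
  case (singleton p)
  then show ?case by (cases p) auto
next
  case (insert p P)
  obtain U1 V1 where p: "p = (U1, V1)" by fastforce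
  have o1: "openin X U1" "U1 \<noteq> {}" "openin X V1" "V1 \<noteq> {}"
    using insert.prems p by auto
  obtain U2 V2 where o2: "openin X U2" "U2 \<noteq> {}" "openin X V2" "V2 \<noteq> {}"
    and P: "\<And>n. \<exists>x\<in>U2. (f ^^ n) x \<in> V2 \<Longrightarrow> \<forall>(U', V')\<in>P. \<exists>x\<in>U'. (f ^^ n) x \<in> V'"
    using insert.IH[OF insert.prems] by blast
  obtain U V where UV: "openin X U" "U \<noteq> {}" "openin X V" "V \<noteq> {}"
    "\<forall>m. (\<exists>x\<in>U. (f ^^ m) x \<in> V) \<longrightarrow> (\<exists>x\<in>U1. (f ^^ m) x \<in> V1) \<and> (\<exists>x\<in>U2. (f ^^ m) x \<in> V2)"
    using weakly_mixing_pair_reduction[OF wm o1 o2] .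
  show ?case
  proof (intro exI conjI allI impI)
    fix n assume "\<exists>x\<in>U. (f ^^ n) x \<in> V"
    from UV(5)[rule_format, OF this] P show "\<forall>(U', V')\<in>insert p P. \<exists>x\<in>U'. (f ^^ n) x \<in> V'"
      unfolding p by blast
  qed (use UV in auto)
qed

lemma weakly_mixing_finite_families:
  assumes "weakly_mixing X f" "finite P" "P \<noteq> {}"
    and "\<And>U V. (U, V) \<in> P \<Longrightarrow> openin X U \<and> U \<noteq> {} \<and> openin X V \<and> V \<noteq> {}"
  obtains n where "n > 0" "\<And>U V. (U, V) \<in> P \<Longrightarrow> \<exists>x\<in>U. (f ^^ n) x \<in> V"
proof -
  obtain U V where UV: "openin X U" "U \<noteq> {}" "openin X V" "V \<noteq> {}"
    "\<And>n. \<exists>x\<in>U. (f ^^ n) x \<in> V \<Longrightarrow> \<forall>(U', V')\<in>P. \<exists>x\<in>U'. (f ^^ n) x \<in> V'"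
    using weakly_mixing_finite_reduction[OF assms] by blast
  \<comment> \<open>Weak mixing applied to the same pair twice is transitivity of \<open>f\<close>.
    Positivity of \<open>n\<close> comes from here.\<close>
  obtain n where n: "n > 0" "\<exists>x\<in>U. (f ^^ n) x \<in> V"
    using assms(1)[unfolded weakly_mixing_iff, THEN conjunct2, rule_format, of U V U V] UV(1-4)
    by blast
  show ?thesis
    using n(1)
  proof (rule that)
    fix U' V' assume "(U', V') \<in> P"
    then show "\<exists>x\<in>U'. (f ^^ n) x \<in> V'" using UV(5)[OF n(2)] by blast
  qed
qed

section \<open>The Hausdorff metric of a bounded metric space\<close>

lemma (in Metric_space) continuous_map_Lipschitz:
  assumes "f ` M \<subseteq> M" and lip: "\<And>x y. x \<in> M \<Longrightarrow> y \<in> M \<Longrightarrow> d (f x) (f y) \<le> c * d x y"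
  shows "continuous_map mtopology mtopology f"
proof -
  have "Lipschitz_continuous_map (metric (M, d)) (metric (M, d)) f"
    unfolding Lipschitz_continuous_map_def using assms by auto
  then show ?thesis
    using Lipschitz_continuous_imp_continuous_map by fastforce
qed

text \<open>Real suprema are meaningful only for sets bounded above. The bound is asked on the whole
  type because the Hausdorff distance must be nonnegative for arbitrary sets before it can be an
  instance of \<open>Metric_space\<close>.\<close>

locale Bounded_metric_space = Metric_space +
  fixes B :: real
  assumes le_bound: "d x y \<le> B"
begin

lemma hausdorff_dist_commute: "hausdorff_dist d K L = hausdorff_dist d L K"
  by (simp add: hausdorff_dist_def commute max.commute)

lemma bdd_below_dist: "bdd_below ((\<lambda>y. d x y) ` L)"
  by (rule bdd_belowI2[of _ 0]) simp

lemma INF_dist_nonneg: "L \<noteq> {} \<Longrightarrow> 0 \<le> (INF y\<in>L. d x y)"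
  by (rule cINF_greatest) auto

lemma bdd_above_INF_dist:
  assumes "L \<noteq> {}"
  shows "bdd_above ((\<lambda>x. INF y\<in>L. d x y) ` K)"
proof (rule bdd_aboveI2)
  fix x
  from assms obtain y where "y \<in> L" by blast
  then have "(INF y\<in>L. d x y) \<le> d x y"
    using bdd_below_dist by (rule cINF_lower[rotated])
  also have "\<dots> \<le> B" by (rule le_bound)
  finally show "(INF y\<in>L. d x y) \<le> B" .
qed

lemma hausdorff_dist_nonneg: "0 \<le> hausdorff_dist d K L"
proof (cases "K = {} \<or> L = {}")
  case False
  then obtain x where x: "x \<in> K" by blast
  have "0 \<le> (INF y\<in>L. d x y)" using False by (simp add: INF_dist_nonneg)
  also have "\<dots> \<le> (SUP x\<in>K. INF y\<in>L. d x y)"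
    using False x by (intro cSUP_upper bdd_above_INF_dist) auto
  finally show ?thesis using False by (simp add: hausdorff_dist_def max_def)
qed (simp add: hausdorff_dist_def)

text \<open>Together with \<open>hausdorff_dist_lessD\<close> this replaces the formula of suprema
  and infima in all later arguments. The converse direction starts from a strict inequality, since
  an infimum need not be attained.\<close>

lemma hausdorff_dist_leI:
  assumes "K \<noteq> {}" "L \<noteq> {}"
    and K: "\<And>x. x \<in> K \<Longrightarrow> \<exists>y\<in>L. d x y \<le> e" and L: "\<And>y. y \<in> L \<Longrightarrow> \<exists>x\<in>K. d x y \<le> e"
  shows "hausdorff_dist d K L \<le> e"
proof -
  have *: "(SUP x\<in>S. INF y\<in>T. d x y) \<le> e"
    if "S \<noteq> {}" and ST: "\<And>x. x \<in> S \<Longrightarrow> \<exists>y\<in>T. d x y \<le> e" for S T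
    using \<open>S \<noteq> {}\<close>
  proof (rule cSUP_least)
    fix x assume "x \<in> S"
    then obtain y where "y \<in> T" "d x y \<le> e" using ST by blast
    with bdd_below_dist show "(INF y\<in>T. d x y) \<le> e" by (rule cINF_lower2)
  qed
  have "(SUP x\<in>K. INF y\<in>L. d x y) \<le> e" using assms(1) K by (rule *)
  moreover have "(SUP y\<in>L. INF x\<in>K. d x y) \<le> e"
    using *[OF assms(2), of K] L by (simp add: commute)
  ultimately show ?thesis using assms by (simp add: hausdorff_dist_def)
qed

lemma hausdorff_dist_lessD:
  assumes "hausdorff_dist d K L < e" "L \<noteq> {}" "x \<in> K"
  shows "\<exists>y\<in>L. d x y < e"
proof -
  have "(INF y\<in>L. d x y) \<le> (SUP x\<in>K. INF y\<in>L. d x y)"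
    using assms by (intro cSUP_upper bdd_above_INF_dist) auto
  also have "\<dots> \<le> hausdorff_dist d K L"
    using assms by (auto simp: hausdorff_dist_def)
  also have "\<dots> < e" by fact
  finally show ?thesis using assms(2) bdd_below_dist by (simp add: cINF_less_iff)
qed

lemma hyperspace_subset: "K \<in> hyperspace M d \<Longrightarrow> K \<subseteq> M"
  using compactin_subset_topspace by (fastforce simp: hyperspace_def)

lemma hyperspace_nonempty: "K \<in> hyperspace M d \<Longrightarrow> K \<noteq> {}"
  by (simp add: hyperspace_def)

lemma finite_in_hyperspace: "finite F \<Longrightarrow> F \<noteq> {} \<Longrightarrow> F \<subseteq> M \<Longrightarrow> F \<in> hyperspace M d"
  by (simp add: hyperspace_def finite_imp_compactin)

text \<open>Distance 0 puts each point of \<open>K\<close> into the closure of \<open>L\<close>, and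
  a compact subset of a metric space is closed.\<close>

lemma hausdorff_dist_zero_imp_subset:
  assumes K: "K \<in> hyperspace M d" and L: "L \<in> hyperspace M d"
    and "hausdorff_dist d K L = 0"
  shows "K \<subseteq> L"
proof
  fix x assume x: "x \<in> K"
  have "closedin mtopology L"
    using L Hausdorff_space_mtopology compactin_imp_closedin by (auto simp: hyperspace_def)
  moreover have "x \<in> mtopology closure_of L"
    unfolding metric_closure_of
  proof (intro CollectI conjI allI impI)
    show "x \<in> M" using x K hyperspace_subset by blast
    fix r :: real assume "r > 0"
    then obtain y where "y \<in> L" "d x y < r"
      using hausdorff_dist_lessD[of K L r x] assms x hyperspace_nonempty by auto
    then show "\<exists>y\<in>L. y \<in> mball x r"
      using \<open>x \<in> M\<close> L hyperspace_subset by auto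
  qed
  ultimately show "x \<in> L" by (simp add: closure_of_closedin)
qed

lemma hausdorff_dist_self: "hausdorff_dist d K K = 0" if "K \<in> hyperspace M d"
proof -
  have "hausdorff_dist d K K \<le> 0"
    using that hyperspace_subset hyperspace_nonempty
    by (intro hausdorff_dist_leI) (auto intro!: bexI simp: subset_iff mdist_zero)
  then show ?thesis using hausdorff_dist_nonneg by (metis antisym)
qed

lemma hausdorff_dist_triangle:
  assumes K: "K \<in> hyperspace M d" and L: "L \<in> hyperspace M d" and N: "N \<in> hyperspace M d"
  shows "hausdorff_dist d K N \<le> hausdorff_dist d K L + hausdorff_dist d L N"
proof (rule field_le_epsilon)
  fix e :: real assume "e > 0"
  \<comment> \<open>\<open>hausdorff_dist_lessD\<close> wants strict bounds, so each distance is
    enlarged by half of the slack \<open>e\<close>.\<close>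
  define a b where "a = hausdorff_dist d K L + e / 2" and "b = hausdorff_dist d L N + e / 2"
  \<comment> \<open>Stated for arbitrary \<open>S\<close> and \<open>T\<close>, so that it leads
    from \<open>K\<close> to \<open>N\<close> and, with \<open>a\<close> and \<open>b\<close>
    exchanged, from \<open>N\<close> to \<open>K\<close>.\<close>
  have near: "\<exists>z\<in>T. d x z \<le> a' + b'"
    if x: "x \<in> S" and S: "hausdorff_dist d S L < a'" "S \<in> hyperspace M d"
      and T: "hausdorff_dist d L T < b'" "T \<in> hyperspace M d" for S T x a' b'
  proof -
    obtain y where y: "y \<in> L" "d x y < a'"
      using hausdorff_dist_lessD[OF S(1) hyperspace_nonempty[OF L] x] by blast
    obtain z where z: "z \<in> T" "d y z < b'"
      using hausdorff_dist_lessD[OF T(1) hyperspace_nonempty[OF T(2)] y(1)] by blast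
    have "d x z \<le> d x y + d y z"
      using x y z S T L hyperspace_subset by (meson subsetD triangle)
    then show ?thesis using y z by force
  qed
  have ab: "hausdorff_dist d K L < a" "hausdorff_dist d L N < b"
    using \<open>e > 0\<close> by (simp_all add: a_def b_def)
  have "hausdorff_dist d K N \<le> a + b"
  proof (rule hausdorff_dist_leI)
    show "K \<noteq> {}" "N \<noteq> {}" using K N hyperspace_nonempty by auto
    show "\<exists>y\<in>N. d x y \<le> a + b" if "x \<in> K" for x
      using near[OF that ab(1) K ab(2) N] .
    show "\<exists>x\<in>K. d x y \<le> a + b" if "y \<in> N" for y
      using near[OF that _ N _ K, of b a] ab by (simp add: hausdorff_dist_commute commute add.commute)
  qed
  then show "hausdorff_dist d K N \<le> hausdorff_dist d K L + hausdorff_dist d L N + e"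
    by (simp add: a_def b_def)
qed

sublocale hyper: Metric_space "hyperspace M d" "hausdorff_dist d"
proof
  show "hausdorff_dist d K L = 0 \<longleftrightarrow> K = L"
    if "K \<in> hyperspace M d" "L \<in> hyperspace M d" for K L
    using that hausdorff_dist_zero_imp_subset hausdorff_dist_commute hausdorff_dist_self
    by (metis subset_antisym)
qed (auto intro: hausdorff_dist_nonneg hausdorff_dist_commute hausdorff_dist_triangle)

text \<open>A compact \<open>K\<close> is totally bounded, and a finite \<open>e/2\<close>-net
  chosen inside \<open>K\<close> has Hausdorff distance at most \<open>e/2\<close> from
  \<open>K\<close>, hence less than \<open>e\<close>.\<close>

lemma finite_dense_hyperspace:
  assumes "openin hyper.mtopology \<U>" "\<U> \<noteq> {}"
  obtains F e where "finite F" "F \<noteq> {}" "F \<subseteq> M" "e > 0" "hyper.mball F e \<subseteq> \<U>"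
proof -
  obtain K e where K: "K \<in> hyperspace M d" and e: "e > 0" "hyper.mball K e \<subseteq> \<U>"
    using assms unfolding hyper.openin_mtopology by blast
  have "mtotally_bounded K"
    using K by (simp add: hyperspace_def compactin_imp_mtotally_bounded)
  then obtain F where F: "finite F" "F \<subseteq> K" "K \<subseteq> (\<Union>x\<in>F. mball x (e/2))"
    using e unfolding mtotally_bounded_def by (meson half_gt_zero)
  have ne: "F \<noteq> {}" using F hyperspace_nonempty[OF K] by auto
  have M: "F \<subseteq> M" using F hyperspace_subset[OF K] by auto
  have "hausdorff_dist d K F \<le> e/2"
  proof (rule hausdorff_dist_leI)
    show "\<exists>y\<in>F. d x y \<le> e/2" if "x \<in> K" for x
    proof -
      obtain y where "y \<in> F" "x \<in> mball y (e/2)" using F(3) \<open>x \<in> K\<close> by blast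
      then show ?thesis by (intro bexI[of _ y]) (auto simp: commute)
    qed
    show "\<exists>x\<in>K. d x y \<le> e/2" if "y \<in> F" for y
      using that F M e by (intro bexI[of _ y]) (auto simp: subset_iff mdist_zero)
  qed (use hyperspace_nonempty[OF K] ne in auto)
  moreover have Fh: "F \<in> hyperspace M d" using F ne M by (intro finite_in_hyperspace)
  ultimately have "F \<in> hyper.mball K e" using K e by simp
  \<comment> \<open>The ball around \<open>K\<close> is open, so it contains a ball centred at the
    net \<open>F\<close> itself.\<close>
  then obtain r where "r > 0" "hyper.mball F r \<subseteq> hyper.mball K e"
    using hyper.openin_mball[of K e] unfolding hyper.openin_mtopology by blast
  then show ?thesis using that F(1) ne M e by blast
qed

section \<open>Weak mixing of the induced map\<close>

text \<open>A Lipschitz bound passes from points to sets: if every point of one set has a point of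
  the other within \<open>r\<close>, the images have this property with
  \<open>max c 0 * r\<close>.\<close>

lemma continuous_map_hyperspace:
  assumes "f ` M \<subseteq> M" and lip: "\<And>x y. x \<in> M \<Longrightarrow> y \<in> M \<Longrightarrow> d (f x) (f y) \<le> c * d x y"
  shows "continuous_map hyper.mtopology hyper.mtopology (\<lambda>K. f ` K)"
proof (rule hyper.continuous_map_Lipschitz)
  have cont: "continuous_map mtopology mtopology f"
    using assms by (rule continuous_map_Lipschitz)
  show "(\<lambda>K. f ` K) ` hyperspace M d \<subseteq> hyperspace M d"
    using image_compactin[OF _ cont] by (auto simp: hyperspace_def)
  fix K L assume K: "K \<in> hyperspace M d" and L: "L \<in> hyperspace M d"
  \<comment> \<open>The sign of \<open>c\<close> is unknown; \<open>max c 0\<close> is a Lipschitz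
    constant by which inequalities can be multiplied.\<close>
  have "d (f x) (f y) \<le> max c 0 * r" if "x \<in> M" "y \<in> M" "d x y < r" for x y r
  proof -
    have "d (f x) (f y) \<le> c * d x y" using that lip by blast
    also have "\<dots> \<le> max c 0 * d x y" by (intro mult_right_mono) auto
    also have "\<dots> \<le> max c 0 * r" using that by (intro mult_left_mono) auto
    finally show ?thesis .
  qed
  note lip' = this
  have near: "\<exists>y\<in>f ` T. d x y \<le> max c 0 * r"
    if x: "x \<in> f ` S" and r: "hausdorff_dist d S T < r"
      and S: "S \<in> hyperspace M d" and T: "T \<in> hyperspace M d" for x r S T
  proof -
    obtain s where s: "s \<in> S" "x = f s" using x by blast
    obtain t where t: "t \<in> T" "d s t < r"
      using hausdorff_dist_lessD[OF r hyperspace_nonempty[OF T] s(1)] by blast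
    have "d x (f t) \<le> max c 0 * r"
      using s t lip' hyperspace_subset[OF S] hyperspace_subset[OF T] by blast
    then show ?thesis using t(1) by blast
  qed
  have r: "hausdorff_dist d (f ` K) (f ` L) \<le> max c 0 * r" if r: "hausdorff_dist d K L < r" for r
  proof (rule hausdorff_dist_leI)
    show "f ` K \<noteq> {}" "f ` L \<noteq> {}" using K L hyperspace_nonempty by auto
    show "\<exists>y\<in>f ` L. d x y \<le> max c 0 * r" if "x \<in> f ` K" for x
      using near[OF that r K L] .
    show "\<exists>x\<in>f ` K. d x y \<le> max c 0 * r" if "y \<in> f ` L" for y
      using near[OF that _ L K] r by (simp add: hausdorff_dist_commute commute)
  qed
  show "hausdorff_dist d (f ` K) (f ` L) \<le> max c 0 * hausdorff_dist d K L"
  proof (rule field_le_epsilon)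
    fix e :: real assume "e > 0"
    define h where "h = hausdorff_dist d K L"
    \<comment> \<open>Dividing by \<open>max c 0 + 1\<close> keeps the added error at most
      \<open>e\<close> after multiplication by \<open>max c 0\<close>, and the denominator is
      positive even if \<open>max c 0\<close> is 0.\<close>
    have "hausdorff_dist d (f ` K) (f ` L) \<le> max c 0 * (h + e / (max c 0 + 1))"
      using \<open>e > 0\<close> by (intro r) (auto simp: h_def intro!: divide_pos_pos)
    also have "\<dots> = max c 0 * h + (max c 0 / (max c 0 + 1)) * e"
      by (simp add: distrib_left)
    also have "\<dots> \<le> max c 0 * h + 1 * e"
      using \<open>e > 0\<close> by (intro add_left_mono mult_right_mono) (auto simp: divide_simps)
    finally show "hausdorff_dist d (f ` K) (f ` L) \<le> max c 0 * hausdorff_dist d K L + e"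
      by (simp add: h_def)
  qed
qed

lemma funpow_image:
  fixes f :: "'b \<Rightarrow> 'b"
  shows "((\<lambda>K. f ` K) ^^ n) K = (f ^^ n) ` K"
  by (induction n) (auto simp: image_comp)

text \<open>Each point of \<open>F \<times> G\<close> contributes one point to \<open>K\<close>, so no matching of \<open>F\<close> with \<open>G\<close> is needed.\<close>

lemma hyperspace_transfer_finite:
  assumes F: "finite F" "F \<noteq> {}" "F \<subseteq> M" and G: "finite G" "G \<noteq> {}" "G \<subseteq> M" and "e > 0"
    and transfer: "\<And>x y. x \<in> F \<Longrightarrow> y \<in> G \<Longrightarrow> \<exists>z\<in>mball x (e/2). (f ^^ n) z \<in> mball y (e/2)"
  shows "\<exists>K\<in>hyper.mball F e. ((\<lambda>K. f ` K) ^^ n) K \<in> hyper.mball G e"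
proof -
  obtain z where z: "\<And>x y. x \<in> F \<Longrightarrow> y \<in> G \<Longrightarrow> z x y \<in> mball x (e/2) \<and> (f ^^ n) (z x y) \<in> mball y (e/2)"
    using transfer by metis
  define K where "K = (\<lambda>(x, y). z x y) ` (F \<times> G)"
  have K: "finite K" "K \<noteq> {}" using F G by (auto simp: K_def)
  have KM: "K \<subseteq> M" "(f ^^ n) ` K \<subseteq> M" using z by (auto simp: K_def)
  have "hausdorff_dist d F K \<le> e/2"
    using F(2) K(2)
  proof (rule hausdorff_dist_leI)
    fix x assume "x \<in> F"
    \<comment> \<open>Any partner \<open>y\<close> will do, since \<open>z x y\<close> is close to
      \<open>x\<close> whatever \<open>y\<close> is.\<close>
    moreover obtain y where "y \<in> G" using G by blast
    ultimately show "\<exists>w\<in>K. d x w \<le> e/2"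
      using z[of x y] by (intro bexI[of _ "z x y"]) (auto simp: K_def)
  next
    fix w assume "w \<in> K"
    then obtain x y where "w = z x y" "x \<in> F" "y \<in> G" by (auto simp: K_def)
    then show "\<exists>x\<in>F. d x w \<le> e/2" using z[of x y] by (intro bexI[of _ x]) auto
  qed
  moreover have "hausdorff_dist d G ((f ^^ n) ` K) \<le> e/2"
  proof (rule hausdorff_dist_leI)
    fix y assume "y \<in> G"
    moreover obtain x where "x \<in> F" using F by blast
    ultimately show "\<exists>w\<in>(f ^^ n) ` K. d y w \<le> e/2"
      using z[of x y] by (intro bexI[of _ "(f ^^ n) (z x y)"]) (auto simp: K_def)
  next
    fix w assume "w \<in> (f ^^ n) ` K"
    then obtain x y where "w = (f ^^ n) (z x y)" "x \<in> F" "y \<in> G" by (auto simp: K_def)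
    then show "\<exists>y\<in>G. d y w \<le> e/2" using z[of x y] by (intro bexI[of _ y]) auto
  qed (use G K in auto)
  moreover have "F \<in> hyperspace M d" "G \<in> hyperspace M d" "K \<in> hyperspace M d"
    "(f ^^ n) ` K \<in> hyperspace M d"
    using F G K KM by (simp_all add: finite_in_hyperspace)
  ultimately show ?thesis using \<open>e > 0\<close> by (intro bexI[of _ K]) (auto simp: funpow_image)
qed

theorem weakly_mixing_hyperspace_iff:
  assumes fM: "f ` M \<subseteq> M" and lip: "\<And>x y. x \<in> M \<Longrightarrow> y \<in> M \<Longrightarrow> d (f x) (f y) \<le> c * d x y"
  shows "weakly_mixing mtopology f \<longleftrightarrow> weakly_mixing hyper.mtopology (\<lambda>K. f ` K)"
proof
  assume wm: "weakly_mixing mtopology f"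
  show "weakly_mixing hyper.mtopology (\<lambda>K. f ` K)"
    unfolding weakly_mixing_iff
  proof (intro conjI allI impI; (elim conjE)?)
    show "continuous_map hyper.mtopology hyper.mtopology (\<lambda>K. f ` K)"
      using assms by (rule continuous_map_hyperspace)
  next
    fix \<U>1 \<V>1 \<U>2 \<V>2
    assume o: "openin hyper.mtopology \<U>1" "\<U>1 \<noteq> {}" "openin hyper.mtopology \<V>1" "\<V>1 \<noteq> {}"
      "openin hyper.mtopology \<U>2" "\<U>2 \<noteq> {}" "openin hyper.mtopology \<V>2" "\<V>2 \<noteq> {}"
    obtain F1 a1 where F1: "finite F1" "F1 \<noteq> {}" "F1 \<subseteq> M" "a1 > 0" "hyper.mball F1 a1 \<subseteq> \<U>1"
      using finite_dense_hyperspace[OF o(1,2)] .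
    obtain G1 b1 where G1: "finite G1" "G1 \<noteq> {}" "G1 \<subseteq> M" "b1 > 0" "hyper.mball G1 b1 \<subseteq> \<V>1"
      using finite_dense_hyperspace[OF o(3,4)] .
    obtain F2 a2 where F2: "finite F2" "F2 \<noteq> {}" "F2 \<subseteq> M" "a2 > 0" "hyper.mball F2 a2 \<subseteq> \<U>2"
      using finite_dense_hyperspace[OF o(5,6)] .
    obtain G2 b2 where G2: "finite G2" "G2 \<noteq> {}" "G2 \<subseteq> M" "b2 > 0" "hyper.mball G2 b2 \<subseteq> \<V>2"
      using finite_dense_hyperspace[OF o(7,8)] .
    define e where "e = min (min a1 b1) (min a2 b2)"
    have e: "e > 0" "e \<le> a1" "e \<le> b1" "e \<le> a2" "e \<le> b2"
      using F1 F2 G1 G2 by (auto simp: e_def)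
    \<comment> \<open>Both pairs of finite sets go into one family of pairs of balls, so that the
      same \<open>n\<close> serves both halves of weak mixing.\<close>
    define P where "P = (\<lambda>(x, y). (mball x (e/2), mball y (e/2))) ` (F1 \<times> G1 \<union> F2 \<times> G2)"
    have "finite P" "P \<noteq> {}" using F1 G1 F2 G2 by (auto simp: P_def)
    moreover have "openin mtopology U \<and> U \<noteq> {} \<and> openin mtopology V \<and> V \<noteq> {}"
      if "(U, V) \<in> P" for U V
      using that F1 G1 F2 G2 e(1) by (auto simp: P_def mball_eq_empty)
    ultimately obtain n where n: "n > 0"
      and P: "\<And>U V. (U, V) \<in> P \<Longrightarrow> \<exists>x\<in>U. (f ^^ n) x \<in> V"
      using weakly_mixing_finite_families[OF wm, of P] by blast
    have z: "\<exists>z\<in>mball x (e/2). (f ^^ n) z \<in> mball y (e/2)"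
      if "(x, y) \<in> F1 \<times> G1 \<union> F2 \<times> G2" for x y
      using that by (intro P) (auto simp: P_def)
    have "\<exists>K\<in>hyper.mball F1 e. ((\<lambda>K. f ` K) ^^ n) K \<in> hyper.mball G1 e"
      by (rule hyperspace_transfer_finite) (use F1 G1 e z in auto)
    moreover have "\<exists>K\<in>hyper.mball F2 e. ((\<lambda>K. f ` K) ^^ n) K \<in> hyper.mball G2 e"
      by (rule hyperspace_transfer_finite) (use F2 G2 e z in auto)
    moreover have "hyper.mball F1 e \<subseteq> \<U>1" "hyper.mball G1 e \<subseteq> \<V>1"
      "hyper.mball F2 e \<subseteq> \<U>2" "hyper.mball G2 e \<subseteq> \<V>2"
      using F1(5) G1(5) F2(5) G2(5) e hyper.mball_subset_concentric by (meson order_trans)+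
    ultimately show "\<exists>n>0. (\<exists>K\<in>\<U>1. ((\<lambda>K. f ` K) ^^ n) K \<in> \<V>1) \<and> (\<exists>K\<in>\<U>2. ((\<lambda>K. f ` K) ^^ n) K \<in> \<V>2)"
      using n by blast
  qed
next
  assume wm: "weakly_mixing hyper.mtopology (\<lambda>K. f ` K)"
  have sub: "\<exists>\<W>. openin hyper.mtopology \<W> \<and> \<W> \<noteq> {} \<and> (\<forall>K\<in>\<W>. K \<noteq> {} \<and> K \<subseteq> U)"
    if U: "openin mtopology U" "U \<noteq> {}" for U
  proof -
    obtain x e where x: "x \<in> M" and e: "e > 0" "mball x e \<subseteq> U"
      using U unfolding openin_mtopology by blast
    have xh: "{x} \<in> hyperspace M d" using x by (simp add: finite_in_hyperspace)
    have "K \<noteq> {} \<and> K \<subseteq> U" if K: "K \<in> hyper.mball {x} e" for K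
    proof -
      \<comment> \<open>The distance is turned around so that \<open>hausdorff_dist_lessD\<close>
        starts from points of \<open>K\<close>; the only point of \<open>{x}\<close> near them is
        \<open>x\<close>.\<close>
      have Kh: "K \<in> hyperspace M d" "hausdorff_dist d K {x} < e"
        using K by (auto simp: hausdorff_dist_commute)
      have "y \<in> mball x e" if "y \<in> K" for y
        using hausdorff_dist_lessD[OF Kh(2) _ that] x that Kh(1) hyperspace_subset
        by (auto simp: commute)
      then show ?thesis using hyperspace_nonempty[OF Kh(1)] e by blast
    qed
    then show ?thesis using xh e(1)
      by (intro exI[of _ "hyper.mball {x} e"]) (auto simp: hyper.mball_eq_empty)
  qed
  show "weakly_mixing mtopology f"
    unfolding weakly_mixing_iff
  proof (intro conjI allI impI; (elim conjE)?)
    show "continuous_map mtopology mtopology f"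
      using assms by (rule continuous_map_Lipschitz)
  next
    fix U1 V1 U2 V2
    assume o: "openin mtopology U1" "U1 \<noteq> {}" "openin mtopology V1" "V1 \<noteq> {}"
      "openin mtopology U2" "U2 \<noteq> {}" "openin mtopology V2" "V2 \<noteq> {}"
    from sub[OF o(1,2)] obtain \<U>1 where U1: "openin hyper.mtopology \<U>1" "\<U>1 \<noteq> {}"
      "\<And>K. K \<in> \<U>1 \<Longrightarrow> K \<noteq> {} \<and> K \<subseteq> U1" by blast
    from sub[OF o(3,4)] obtain \<V>1 where V1: "openin hyper.mtopology \<V>1" "\<V>1 \<noteq> {}"
      "\<And>K. K \<in> \<V>1 \<Longrightarrow> K \<noteq> {} \<and> K \<subseteq> V1" by blast
    from sub[OF o(5,6)] obtain \<U>2 where U2: "openin hyper.mtopology \<U>2" "\<U>2 \<noteq> {}"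
      "\<And>K. K \<in> \<U>2 \<Longrightarrow> K \<noteq> {} \<and> K \<subseteq> U2" by blast
    from sub[OF o(7,8)] obtain \<V>2 where V2: "openin hyper.mtopology \<V>2" "\<V>2 \<noteq> {}"
      "\<And>K. K \<in> \<V>2 \<Longrightarrow> K \<noteq> {} \<and> K \<subseteq> V2" by blast
    obtain n where n: "n > 0" "\<exists>K\<in>\<U>1. ((\<lambda>K. f ` K) ^^ n) K \<in> \<V>1"
      "\<exists>K\<in>\<U>2. ((\<lambda>K. f ` K) ^^ n) K \<in> \<V>2"
      using wm[unfolded weakly_mixing_iff, THEN conjunct2, rule_format, of \<U>1 \<V>1 \<U>2 \<V>2]
        U1(1,2) V1(1,2) U2(1,2) V2(1,2) by blast
    then obtain K1 K2 where "K1 \<in> \<U>1" "(f ^^ n) ` K1 \<in> \<V>1" "K2 \<in> \<U>2" "(f ^^ n) ` K2 \<in> \<V>2"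
      unfolding funpow_image by blast
    \<comment> \<open>Any point of \<open>K1\<close> now starts in \<open>U1\<close> and lands in
      \<open>V1\<close>; likewise for \<open>K2\<close>.\<close>
    then have "K1 \<noteq> {}" "K1 \<subseteq> U1" "(f ^^ n) ` K1 \<subseteq> V1" "K2 \<noteq> {}" "K2 \<subseteq> U2" "(f ^^ n) ` K2 \<subseteq> V2"
      using U1(3) V1(3) U2(3) V2(3) by auto
    then show "\<exists>n>0. (\<exists>x\<in>U1. (f ^^ n) x \<in> V1) \<and> (\<exists>x\<in>U2. (f ^^ n) x \<in> V2)"
      using n(1) by blast
  qed
qed

end

section \<open>Sequence spaces\<close>

text \<open>The function \<open>t / (1 + t)\<close> is increasing, and it is subadditive: split the
  fraction at \<open>s + t\<close> into two and shrink each denominator.\<close>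

lemma Metric_space_capped:
  assumes "Metric_space A d"
  shows "Metric_space A (\<lambda>x y. d x y / (1 + d x y))"
proof -
  interpret Metric_space A d by fact
  show ?thesis
  proof
    show "d x z / (1 + d x z) \<le> d x y / (1 + d x y) + d y z / (1 + d y z)"
      if "x \<in> A" "y \<in> A" "z \<in> A" for x y z
    proof -
      have mono: "s / (1 + s) \<le> t / (1 + t)" if "0 \<le> s" "s \<le> t" for s t :: real
        using that by (simp add: divide_simps) (simp add: algebra_simps)
      have "d x z / (1 + d x z) \<le> (d x y + d y z) / (1 + (d x y + d y z))"
        using that triangle by (intro mono) auto
      also have "\<dots> = d x y / (1 + (d x y + d y z)) + d y z / (1 + (d x y + d y z))"
        by (simp add: add_divide_distrib)
      also have "\<dots> \<le> d x y / (1 + d x y) + d y z / (1 + d y z)"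
        by (intro add_mono divide_left_mono) (auto simp: add_pos_nonneg)
      finally show ?thesis .
    qed
    show "d x y / (1 + d x y) = 0 \<longleftrightarrow> x = y" if "x \<in> A" "y \<in> A" for x y
      using that nonneg[of x y] by (auto simp: add_nonneg_eq_0_iff)
  qed (auto simp: commute)
qed

text \<open>The common form of both metrics on sequences: \<open>g\<close> is the discrete metric or
  the capped metric \<open>d / (1 + d)\<close>.\<close>

definition weighted_dist :: "('a \<Rightarrow> 'a \<Rightarrow> real) \<Rightarrow> (nat \<Rightarrow> 'a) \<Rightarrow> (nat \<Rightarrow> 'a) \<Rightarrow> real" where
  "weighted_dist g x y = (\<Sum>i. g (x i) (y i) / 2 ^ i)"

text \<open>With the bound on the whole type, the series converges for arbitrary sequences and stays
  below the geometric sum 2, as \<open>le_bound\<close> demands.\<close>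

context
  fixes A :: "'a set" and g :: "'a \<Rightarrow> 'a \<Rightarrow> real"
  assumes g: "Metric_space A g" and g_le_1: "\<And>a b. g a b \<le> 1"
begin

interpretation g: Metric_space A g by (rule g)

lemma weighted_dist_summable: "summable (\<lambda>i. g (x i) (y i) / 2 ^ i)"
proof (rule summable_comparison_test')
  show "summable (\<lambda>i. (1/2) ^ i :: real)" by (rule summable_geometric) simp
  show "norm (g (x n) (y n) / 2 ^ n) \<le> (1/2) ^ n" for n
    using g_le_1 by (simp add: power_divide divide_right_mono)
qed

lemma weighted_dist_nonneg: "0 \<le> weighted_dist g x y"
  unfolding weighted_dist_def by (intro suminf_nonneg weighted_dist_summable) simp

lemma weighted_dist_le_2: "weighted_dist g x y \<le> 2"
proof -
  have "weighted_dist g x y \<le> (\<Sum>i. (1/2) ^ i)"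
    unfolding weighted_dist_def
    by (intro suminf_le weighted_dist_summable summable_geometric)
      (use g_le_1 in \<open>auto simp: power_divide divide_right_mono\<close>)
  then show ?thesis by (simp add: suminf_geometric)
qed

lemma Bounded_metric_space_weighted_dist:
  "Bounded_metric_space (full_space A) (weighted_dist g) 2"
proof
  show "weighted_dist g x y = 0 \<longleftrightarrow> x = y" if "x \<in> full_space A" "y \<in> full_space A" for x y
  proof -
    have "weighted_dist g x y = 0 \<longleftrightarrow> (\<forall>i. g (x i) (y i) / 2 ^ i = 0)"
      unfolding weighted_dist_def by (intro suminf_eq_zero_iff weighted_dist_summable) simp
    also have "\<dots> \<longleftrightarrow> x = y" using that by (auto simp: fun_eq_iff Pi_iff)
    finally show ?thesis .
  qed
  show "weighted_dist g x z \<le> weighted_dist g x y + weighted_dist g y z"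
    if "x \<in> full_space A" "y \<in> full_space A" "z \<in> full_space A" for x y z
    unfolding weighted_dist_def suminf_add[OF weighted_dist_summable weighted_dist_summable]
      add_divide_distrib[symmetric]
  proof (rule suminf_le)
    show "g (x n) (z n) / 2 ^ n \<le> (g (x n) (y n) + g (y n) (z n)) / 2 ^ n" for n
      using that by (intro divide_right_mono g.triangle) auto
    show "summable (\<lambda>n. (g (x n) (y n) + g (y n) (z n)) / 2 ^ n)"
      unfolding add_divide_distrib by (intro summable_add weighted_dist_summable)
  qed (rule weighted_dist_summable)
qed (use weighted_dist_nonneg weighted_dist_le_2 in \<open>auto simp: weighted_dist_def g.commute\<close>)

text \<open>Shifting drops the nonnegative term at index 0 and doubles every remaining weight, which
  gives the Lipschitz constant 2.\<close>

lemma weighted_dist_shift: "weighted_dist g (shift x) (shift y) \<le> 2 * weighted_dist g x y"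
proof -
  have "weighted_dist g x y = (\<Sum>i. g (x (Suc i)) (y (Suc i)) / 2 ^ Suc i) + g (x 0) (y 0)"
    unfolding weighted_dist_def
    using suminf_split_head[OF weighted_dist_summable[of x y]] by simp
  also have "(\<Sum>i. g (x (Suc i)) (y (Suc i)) / 2 ^ Suc i) = weighted_dist g (shift x) (shift y) / 2"
    unfolding weighted_dist_def
    using suminf_divide[OF weighted_dist_summable[of "shift x" "shift y"], of 2]
    by (simp add: shift_def mult.commute)
  finally show ?thesis by simp
qed

theorem weakly_mixing_weighted_subshift:
  assumes "subshift A (weighted_dist g) \<Omega>"
  shows "weakly_mixing (Metric_space.mtopology \<Omega> (weighted_dist g)) shift \<longleftrightarrow>
    weakly_mixing (Metric_space.mtopology (hyperspace \<Omega> (weighted_dist g))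
      (hausdorff_dist (weighted_dist g))) (\<lambda>K. shift ` K)"
proof -
  interpret full: Bounded_metric_space "full_space A" "weighted_dist g" 2
    by (rule Bounded_metric_space_weighted_dist)
  \<comment> \<open>A closed set lies in the underlying space, so \<open>\<Omega>\<close> inherits
    the metric together with its bound.\<close>
  have "\<Omega> \<subseteq> full_space A" and shift: "shift ` \<Omega> \<subseteq> \<Omega>"
    using assms closedin_subset by (fastforce simp: subshift_def)+
  then have "Bounded_metric_space \<Omega> (weighted_dist g) 2"
    by (simp add: Bounded_metric_space.intro Bounded_metric_space_axioms.intro
        full.subspace full.le_bound)
  then show ?thesis
    using shift
    by (rule Bounded_metric_space.weakly_mixing_hyperspace_iff[where c = 2])
      (rule weighted_dist_shift)
qed

end

theorem proposition3p10:
  fixes A :: "'a set"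
    and d :: "'a \<Rightarrow> 'a \<Rightarrow> real"
    and D :: "(nat \<Rightarrow> 'a) \<Rightarrow> (nat \<Rightarrow> 'a) \<Rightarrow> real"
    and \<Omega> :: "(nat \<Rightarrow> 'a) set"
  assumes "D = seq_dist_discrete \<or> (Metric_space A d \<and> D = seq_dist_metric d)"
    and "subshift A D \<Omega>"
  shows "weakly_mixing (Metric_space.mtopology \<Omega> D) shift \<longleftrightarrow>
         weakly_mixing (Metric_space.mtopology (hyperspace \<Omega> D) (hausdorff_dist D)) (\<lambda>K. shift ` K)"
proof -
  \<comment> \<open>Both kinds of alphabet reduce to a metric \<open>g\<close> bounded by 1.\<close>
  have "\<exists>g. Metric_space A g \<and> (\<forall>a b. g a b \<le> 1) \<and> D = weighted_dist g"
    using assms(1)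
  proof
    assume "D = seq_dist_discrete"
    then have "D = weighted_dist discrete_metric.dd"
      by (simp add: fun_eq_iff seq_dist_discrete_def weighted_dist_def)
    then show ?thesis
      using metric_M_dd discrete_metric.dd_le1 by blast
  next
    assume *: "Metric_space A d \<and> D = seq_dist_metric d"
    then interpret Metric_space A d by blast
    have "D = weighted_dist (\<lambda>a b. d a b / (1 + d a b))"
      using * by (simp add: fun_eq_iff seq_dist_metric_def weighted_dist_def mult.commute)
    \<comment> \<open>This holds also outside \<open>A\<close>, because nonnegativity in
      \<open>Metric_space\<close> is not restricted to the carrier.\<close>
    moreover have "d a b / (1 + d a b) \<le> 1" for a b
      using nonneg[of a b] by (auto simp: divide_simps not_less)
    ultimately show ?thesis using Metric_space_capped[of A d] * by blast
  qed
  then show ?thesis using weakly_mixing_weighted_subshift assms(2) by blast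
qed

end
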